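(* For every $s\in\mathbb N$ and every real $t>0$, $$\frac{t}{t+s}\,p_{s-1}(t)\;<\;F_s(t)\;<\;\frac{t}{t+s-1}\,p_{s-1}(t).$$
   Context: $\mathbb N=\{1,2,3,\dots\}$. For $n\in\mathbb N_0=\{0,1,2,\dots\}$ and $t\in\mathbb R$ put $p_n(t):=t^n/n!$. For $s\in\mathbb N_0$ put $F_s(t):=(-1)^s\sum_{n=s}^{\infty}(-1)^n p_n(t)$, i.e. up to sign the $s$-th remainder of the Taylor series of $\exp(-t)$. *)

theory Defs
  imports Complex_Main
begin

definition p :: "nat \<Rightarrow> real \<Rightarrow> real" where
  "p n t = t ^ n / fact n"

text \<open>The series over \<open>n \<ge> s\<close> is written with the index shifted, \<open>n = k + s\<close>.\<close>

definition F :: "nat \<Rightarrow> real \<Rightarrow> real" where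
  "F s t = (-1) ^ s * (\<Sum>k. (-1) ^ (k + s) * p (k + s) t)"

lemma summable_F: "summable (\<lambda>k. (-1) ^ (k + s) * p (k + s) t)"
proof -
  have "(\<lambda>n. (-1) ^ n * p n t) = (\<lambda>n. (- t) ^ n /\<^sub>R fact n)"
    by (auto simp: p_def fun_eq_iff power_minus[of t] divide_inverse)
  then have "summable (\<lambda>n. (-1) ^ n * p n t)"
    using summable_exp_generic[of "- t"] by simp
  then show ?thesis
    by (rule summable_ignore_initial_segment)
qed

end

theory Submission
  imports Defs
begin

text \<open>The remainders satisfy \<open>F (Suc n) + F n = p n\<close> and \<open>F (Suc n)' = F n\<close>, so \<open>y = F (Suc n)\<close>
  solves \<open>y' + y = p n\<close>, \<open>y 0 = 0\<close>. The lower bound \<open>L t = t / (t + n + 1) * p n t\<close> satisfies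
  \<open>L' + L = (1 - t / (t + n + 1)\<^sup>2) * p n < p n\<close> and \<open>L 0 = 0\<close>, so \<open>exp t * (y t - L t)\<close> is strictly
  increasing from \<open>0\<close>. The upper bound for \<open>F s\<close> follows from the lower bound for
  \<open>F (s - 1) = p (s - 1) - F s\<close>, or from \<open>F 0 t = exp (- t) > 0\<close> when \<open>s = 1\<close>.\<close>

lemma F_0: "F 0 t = exp (- t)"
proof -
  have "(\<lambda>n. (-1) ^ n * p n t) = (\<lambda>n. (- t) ^ n /\<^sub>R fact n)"
    by (auto simp: p_def fun_eq_iff power_minus[of t] divide_inverse)
  then show ?thesis
    by (simp add: F_def exp_def)
qed

text \<open>Split off the \<open>k = 0\<close> term of the series for \<open>F n\<close>; the
  additional sign in \<open>(-1) ^ Suc n\<close> negates what is left.\<close>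

lemma F_Suc: "F (Suc n) t = p n t - F n t"
proof -
  have "(\<Sum>k. (-1) ^ (k + Suc n) * p (k + Suc n) t)
      = (\<Sum>k. (-1) ^ (k + n) * p (k + n) t) - (-1) ^ n * p n t"
    using suminf_split_head[OF summable_F[where s = n and t = t]] by simp
  moreover have "(-1) ^ n * ((-1) ^ n * p n t) = p n t"
    by (simp flip: mult.assoc power_mult_distrib)
  ultimately show ?thesis
    unfolding F_def by (simp only: power_Suc right_diff_distrib)
qed

lemma mult_p: "t * p n t = (real n + 1) * p (Suc n) t"
  by (simp add: p_def divide_simps algebra_simps del: of_nat_Suc) (simp add: algebra_simps)

lemma p_pos: "t > 0 \<Longrightarrow> p n t > 0"
  by (simp add: p_def)

lemma DERIV_p_Suc: "(p (Suc n) has_real_derivative p n t) (at t)"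
proof -
  have "((\<lambda>t. t ^ Suc n / fact (Suc n)) has_real_derivative (real (Suc n) * t ^ n) / fact (Suc n)) (at t)"
    by (rule DERIV_cdivide) (use DERIV_pow[of "Suc n" t] in simp)
  moreover have "(real (Suc n) * t ^ n) / fact (Suc n) = p n t"
    by (simp add: p_def del: of_nat_Suc)
  ultimately show ?thesis
    by (simp add: p_def[abs_def])
qed

text \<open>Induction along \<open>F_Suc\<close>, starting from \<open>F_0\<close>, avoids
  differentiating the series termwise.\<close>

lemma DERIV_F_Suc: "(F (Suc n) has_real_derivative F n t) (at t)"
proof (induction n)
  case 0
  have "F (Suc 0) = (\<lambda>t. 1 - exp (- t))"
    by (simp add: fun_eq_iff F_Suc F_0 p_def)
  then show ?case
    by (auto intro!: derivative_eq_intros simp: F_0)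
next
  case (Suc n)
  have "((\<lambda>t. p (Suc n) t - F (Suc n) t) has_real_derivative p n t - F n t) (at t)"
    by (intro DERIV_diff DERIV_p_Suc Suc.IH)
  moreover have "F (Suc (Suc n)) = (\<lambda>t. p (Suc n) t - F (Suc n) t)"
    by (simp add: fun_eq_iff F_Suc)
  ultimately show ?case
    by (simp add: F_Suc)
qed

lemma F_Suc_0: "F (Suc n) 0 = 0"
proof (induction n)
  case 0
  show ?case by (simp add: F_Suc F_0 p_def)
next
  case (Suc n)
  then show ?case by (simp add: F_Suc[of "Suc n"] p_def)
qed

lemma F_Suc_lower:
  assumes "t > 0"
  shows "t / (t + real n + 1) * p n t < F (Suc n) t"
proof -
  \<comment> \<open>By \<open>mult_p\<close> this equals the claimed bound; with
    \<open>p (Suc n)\<close> in the numerator, \<open>DERIV_p_Suc\<close> applies without a special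
    case for \<open>n = 0\<close>.\<close>
  define L where "L x = (real n + 1) * p (Suc n) x / (x + real n + 1)" for x
  define G where "G x = exp x * (F (Suc n) x - L x)" for x
  have deriv: "(G has_real_derivative exp x * (p n x * (x / (x + real n + 1)\<^sup>2))) (at x)"
    if "x \<ge> 0" for x
  proof -
    define c where "c = x + real n + 1"
    have c: "c > 0" and n: "real n + 1 = c - x" using that by (simp_all add: c_def)
    have "(L has_real_derivative
        ((real n + 1) * p n x * c - (real n + 1) * p (Suc n) x) / c\<^sup>2) (at x)"
      unfolding L_def c_def using that
      by (auto intro!: derivative_eq_intros DERIV_p_Suc simp: power2_eq_square)
    then have "(G has_real_derivative exp x * (F (Suc n) x - L x) +
        (F n x - ((real n + 1) * p n x * c - (real n + 1) * p (Suc n) x) / c\<^sup>2) * exp x) (at x)"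
      unfolding G_def by (rule DERIV_mult'[OF DERIV_exp DERIV_diff[OF DERIV_F_Suc], THEN DERIV_cong]) simp
    moreover have "exp x * (F (Suc n) x - L x) +
        (F n x - ((real n + 1) * p n x * c - (real n + 1) * p (Suc n) x) / c\<^sup>2) * exp x
        = exp x * (p n x * (x / c\<^sup>2))"
    proof -
      have "L x = x * p n x / c" by (simp add: L_def c_def mult_p)
      \<comment> \<open>The remainders cancel since \<open>F (Suc n) x + F n x = p n x\<close>.
        Writing \<open>real n + 1\<close> as \<open>c - x\<close> leaves a rational identity in
        \<open>x\<close>, \<open>c\<close> and \<open>p n x\<close>.\<close>
      then have "F (Suc n) x - L x
          + (F n x - ((real n + 1) * p n x * c - (real n + 1) * p (Suc n) x) / c\<^sup>2)
          = p n x - x * p n x / c - ((c - x) * p n x * c - x * p n x) / c\<^sup>2"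
        unfolding mult_p[symmetric] by (simp add: F_Suc n)
      also have "\<dots> = p n x * (x / c\<^sup>2)"
        using c by (simp add: field_simps power2_eq_square)
      finally show ?thesis
        by (metis (no_types) distrib_left mult.commute)
    qed
    ultimately show ?thesis by (simp add: c_def)
  qed
  have "G 0 < G t"
  \<comment> \<open>The derivative vanishes at \<open>0\<close>, so positivity is available only on
    the open interval; continuity takes care of the endpoints.\<close>
  proof (rule DERIV_pos_imp_increasing_open[OF assms])
    show "\<exists>y. (G has_real_derivative y) (at x) \<and> y > 0" if "0 < x" "x < t" for x
      by (intro exI conjI, rule deriv) (use that p_pos[of x n] in auto)
    show "continuous_on {0..t} G"
      by (rule DERIV_continuous_on) (auto intro!: DERIV_subset[OF deriv])
  qed
  moreover have "G 0 = 0"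
    by (simp add: G_def L_def F_Suc_0 p_def)
  ultimately have "L t < F (Suc n) t"
    by (simp add: G_def zero_less_mult_iff)
  then show ?thesis
    by (simp add: L_def mult_p)
qed

lemma F_Suc_upper:
  assumes "t > 0"
  shows "F (Suc n) t < t / (t + real n) * p n t"
proof (cases n)
  case 0
  then show ?thesis using assms by (simp add: F_Suc F_0 p_def)
next
  case (Suc m)
  have "(real m + 1) * p n t / (t + real m + 1) < F n t"
    using F_Suc_lower[OF assms, of m] by (simp add: Suc mult_p)
  \<comment> \<open>Since \<open>real m + 1 = real n\<close>, this is
    \<open>1 - n / (t + n) = t / (t + n)\<close>.\<close>
  moreover have "p n t - (real m + 1) * p n t / (t + real m + 1) = t / (t + real n) * p n t"
    using assms by (simp add: Suc field_simps)
  ultimately show ?thesis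
    by (simp add: F_Suc)
qed

theorem theorem3p2:
  fixes s :: nat and t :: real
  assumes "s \<ge> 1" and "t > 0"
  shows "t / (t + real s) * p (s - 1) t < F s t \<and>
         F s t < t / (t + real s - 1) * p (s - 1) t"
proof -
  obtain n where "s = Suc n" using assms(1) by (cases s) auto
  then show ?thesis
    using F_Suc_lower[OF assms(2), of n] F_Suc_upper[OF assms(2), of n] by (simp add: add_ac)
qed

end
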